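(* Let $K\ge1$ be an integer, $\sigma^2\ge 0$, and let $h$, $\mathcal{R}_\pi$, $\Pi$, $h_{\min}$, $h_{\max}$, $A_{h_0}$, $B_{h_0}$, $f$ and $\sigma^2_{\min}$ be as defined in the context. (i) If $\sigma^2\le\sigma^2_{\min}$, then the design $\pi^*(x)=\dfrac{h(x)}{\int_{-1}^1 h(t)\,dt}$ satisfies $\mathcal{R}_{\pi^*}\le\mathcal{R}_\pi$ for all $\pi\in\Pi$. (ii) If $\sigma^2>\sigma^2_{\min}$, let $h_0^*\in[h_{\min},h_{\max}]$ be such that $f(h_0^* )=-\dfrac{2}{\sigma^2}$. Then the design $$\pi^*(x)=\begin{cases} c\,\{h_0^*h(x)\}^{1/2}, & x\in A_{h_0^*},\\ c\,h(x), & x\in B_{h_0^*},\end{cases}$$ where $c$ is the normalizing constant (making $\int_{-1}^1\pi^*(x)\,dx=1$), satisfies $\mathcal{R}_{\pi^*}\le\mathcal{R}_\pi$ for all $\pi\in\Pi$.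
   Context: For $x\in[-1,1]$ let $\vec{x}=(1,x,\dots,x^K)$ (a row vector), $Q=\int_{-1}^1\frac12\vec{x}^T\vec{x}\,dx$, and $h(x)=\vec{x}\,Q^{-1}\vec{x}^T$, a strictly positive polynomial. Let $$\Pi=\left\{\pi:[-1,1]\to\mathbb{R}^+ \text{ such that }\int_{-1}^1\pi(x)\,dx=1\right\}$$ be the space of designs (probability densities on $[-1,1]$). For $\pi\in\Pi$ define $$\mathcal{R}_\pi=\frac{\sigma^2}{2}\int_{-1}^1\frac{h(x)}{\pi(x)}\,dx+\sup_{x\in[-1,1]}\frac{h(x)}{\pi(x)}\in(0,\infty],$$ with $h(x)/\pi(x)=+\infty$ when $\pi(x)=0$ (and $0\cdot\infty=0$). Let $h_{\min}=\min_{x\in[-1,1]}h(x)$ and $h_{\max}=\max_{x\in[-1,1]}h(x)$. For $h_0\in[h_{\min},h_{\max}]$ let $$A_{h_0}=\{x\in[-1,1]:h(x)\le h_0\},\qquad B_{h_0}=\{x\in[-1,1]:h(x)>h_0\},\qquad f(h_0)=\frac{\int_{B_{h_0}}\{h_0-h(x)\}\,dx}{h_0}.$$ Let $\sigma^2_{\min}=-\dfrac{2}{f(h_{\min})}$. The function $f$ is increasing with $f(h_{\max})=0$, so that when $\sigma^2>\sigma^2_{\min}$ the solution $h_0^*$ of $f(h_0^* )=-2/\sigma^2$ exists and is unique. *)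

theory Defs
  imports "HOL-Analysis.Analysis" "Jordan_Normal_Form.Gauss_Jordan_Elimination"
begin

definition regvec :: "nat \<Rightarrow> real \<Rightarrow> real Matrix.vec" where
  "regvec K x = Matrix.vec (K + 1) (\<lambda>i. x ^ i)"

definition Qmat :: "nat \<Rightarrow> real Matrix.mat" where
  "Qmat K = Matrix.mat (K + 1) (K + 1) (\<lambda>(i, j).
     LINT x:{-1..1}|lebesgue. 1/2 * (vec_index (regvec K x) i * vec_index (regvec K x) j))"

text \<open>The matrix \<^term>\<open>Qmat K\<close> is the Gram matrix of linearly independent monomials, hence
  invertible, so \<^const>\<open>mat_inverse\<close> does not return \<^const>\<open>None\<close> here.\<close>

definition hfun :: "nat \<Rightarrow> real \<Rightarrow> real" where
  "hfun K x = scalar_prod (regvec K x) (mult_mat_vec (the (mat_inverse (Qmat K))) (regvec K x))"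

text \<open>Designs are functions on \<^term>\<open>{-1..1::real}\<close>; the values of \<^term>\<open>\<pi>\<close> outside this interval
  are irrelevant. Zero values are allowed, and all integrals are Lebesgue integrals.\<close>

definition designs :: "(real \<Rightarrow> real) set" where
  "designs = {\<pi>. (\<forall>x\<in>{-1..1}. 0 \<le> \<pi> x) \<and> set_integrable lebesgue {-1..1} \<pi> \<and>
     (LINT x:{-1..1}|lebesgue. \<pi> x) = 1}"

definition hratio :: "nat \<Rightarrow> (real \<Rightarrow> real) \<Rightarrow> real \<Rightarrow> ennreal" where
  "hratio K \<pi> x = (if \<pi> x = 0 then \<infinity> else ennreal (hfun K x / \<pi> x))"

text \<open>The supremum is pointwise, not essential. In \<^typ>\<open>ennreal\<close>, \<open>0 * \<infinity> = 0\<close>.\<close>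

definition risk :: "nat \<Rightarrow> real \<Rightarrow> (real \<Rightarrow> real) \<Rightarrow> ennreal" where
  "risk K \<sigma>2 \<pi> = ennreal (\<sigma>2 / 2) * (\<integral>\<^sup>+x\<in>{-1..1}. hratio K \<pi> x \<partial>lebesgue)
     + (SUP x\<in>{-1..1}. hratio K \<pi> x)"

definition hmin :: "nat \<Rightarrow> real" where
  "hmin K = (LEAST y. y \<in> hfun K ` {-1..1})"

definition hmax :: "nat \<Rightarrow> real" where
  "hmax K = (GREATEST y. y \<in> hfun K ` {-1..1})"

definition Aset :: "nat \<Rightarrow> real \<Rightarrow> real set" where
  "Aset K h0 = {x \<in> {-1..1}. hfun K x \<le> h0}"

definition Bset :: "nat \<Rightarrow> real \<Rightarrow> real set" where
  "Bset K h0 = {x \<in> {-1..1}. hfun K x > h0}"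

definition ffun :: "nat \<Rightarrow> real \<Rightarrow> real" where
  "ffun K h0 = (LINT x:Bset K h0|lebesgue. h0 - hfun K x) / h0"

definition sigma2_min :: "nat \<Rightarrow> real" where
  "sigma2_min K = - 2 / ffun K (hmin K)"

definition design_small :: "nat \<Rightarrow> real \<Rightarrow> real" where
  "design_small K x = hfun K x / (LINT t:{-1..1}|lebesgue. hfun K t)"

definition design_large_shape :: "nat \<Rightarrow> real \<Rightarrow> real \<Rightarrow> real" where
  "design_large_shape K h0 x = (if x \<in> Aset K h0 then sqrt (h0 * hfun K x) else hfun K x)"

definition design_large :: "nat \<Rightarrow> real \<Rightarrow> real \<Rightarrow> real" where
  "design_large K h0 x =
     (let c = 1 / (LINT t:{-1..1}|lebesgue. design_large_shape K h0 t)
      in c * design_large_shape K h0 x)"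

end

theory Submission imports Defs "Jordan_Normal_Form.Determinant" begin

text \<open>
  The risk is a convex functional of the design, and both optimal designs are certified by the same
  weak duality argument. Let \<open>h\<close> stand for \<^term>\<open>hfun K\<close> and \<open>s\<close> for \<open>\<sigma>\<^sup>2\<close>. A supremum dominates every
  weighted average, so for each weight \<open>w \<ge> 0\<close> on \<open>[-1,1]\<close> of total mass 1 and every design \<open>\<pi>\<close>,
  the risk of \<open>\<pi>\<close> is at least \<open>\<integral> g h / \<pi>\<close> where \<open>g = s/2 + w\<close>. If \<open>g h = \<kappa> p\<^sup>2\<close> for a design \<open>p\<close>, the
  inequality \<open>p\<^sup>2 / \<pi> \<ge> 2 p - \<pi>\<close> (a pointwise form of Cauchy-Schwarz) bounds that integral below by
  \<open>\<kappa> (2 - 1) = \<kappa>\<close>: this is \<open>risk_lower_bound\<close>. The design \<open>p\<close> itself attains \<open>\<kappa>\<close> as soon as \<open>w\<close> lives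
  only where \<open>h / p\<close> is maximal, which is complementary slackness: this is \<open>risk_upper_bound\<close>.

  It remains to name the weights. They are given through \<open>g\<close>, which must satisfy \<open>g \<ge> s/2\<close> and
  \<open>\<integral> g = s + 1\<close>.
  \<^item> If \<open>p\<close> is proportional to \<open>h\<close>, the ratio \<open>h / p\<close> is constant and \<open>g\<close> must be the multiple
    \<open>(s + 1) h / \<integral> h\<close> of \<open>h\<close>. The requirement \<open>g \<ge> s/2\<close> is tightest at the
    minimum of \<open>h\<close>, where it follows from \<^term>\<open>s \<le> sigma2_min K\<close>.
  \<^item> Otherwise \<open>g = s / (2 h\<^sub>0) \<cdot> max h h\<^sub>0\<close>, so that \<open>w\<close> vanishes on \<^term>\<open>Aset K h0\<close> and \<open>g h\<close> is
    proportional to \<open>h max h h\<^sub>0\<close>, the square of the shape of the claimed design. The mass condition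
    on \<open>g\<close> is exactly the equation \<^term>\<open>ffun K h0 = - 2 / s\<close>.

  Throughout, \<open>h\<close> has to be continuous and strictly positive. Positivity comes from the Gram matrix
  \<^term>\<open>Qmat K\<close> being positive definite, since a polynomial whose square has integral zero
  over \<open>[-1,1]\<close> has zero coefficients.
\<close>

section \<open>Continuous functions on the design interval\<close>

lemma set_integrable_continuous:
  fixes f :: "real \<Rightarrow> real"
  assumes "continuous_on {a..b} f"
  shows "set_integrable lebesgue {a..b} f"
  using assms by (rule absolutely_integrable_continuous_real)

lemma LINT_continuous_eq_integral:
  fixes f :: "real \<Rightarrow> real"
  assumes "continuous_on {a..b} f"
  shows "(LINT x:{a..b}|lebesgue. f x) = integral {a..b} f"
  by (rule set_lebesgue_integral_eq_integral(2)[OF set_integrable_continuous[OF assms]])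

lemma LINT_const_design_interval:
  fixes c :: real
  shows "(LINT x:{-1..1::real}|lebesgue. c) = 2 * c"
  by (subst LINT_continuous_eq_integral) auto

lemma LINT_continuous_pos:
  fixes f :: "real \<Rightarrow> real"
  assumes cont: "continuous_on {a..b} f" and "a < b" and pos: "\<And>x. x \<in> {a..b} \<Longrightarrow> 0 < f x"
  shows "0 < (LINT x:{a..b}|lebesgue. f x)"
proof -
  have "integral {a..b} f \<noteq> 0"
    using integral_eq_0_iff[OF cont \<open>a < b\<close>] pos \<open>a < b\<close> less_imp_le
    by (metis atLeastAtMost_iff less_irrefl order_refl)
  moreover have "0 \<le> integral {a..b} f"
    using pos by (intro integral_nonneg integrable_continuous_real cont) (auto intro: less_imp_le)
  ultimately show ?thesis
    by (simp add: LINT_continuous_eq_integral[OF cont])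
qed

section \<open>Positivity of the variance function\<close>

lemma regvec_carrier [simp]: "regvec K x \<in> carrier_vec (Suc K)"
  by (simp add: regvec_def)

lemma regvec_index [simp]: "i < Suc K \<Longrightarrow> vec_index (regvec K x) i = x ^ i"
  by (simp add: regvec_def)

lemma Qmat_carrier [simp]: "Qmat K \<in> carrier_mat (Suc K) (Suc K)"
  by (simp add: Qmat_def)

lemma scalar_prod_regvec:
  "scalar_prod u (regvec K x) = (\<Sum>i\<le>K. vec_index u i * x ^ i)"
proof -
  have "{0..<Suc K} = {..K}" by auto
  then have "{0..<dim_vec (regvec K x)} = {..K}" by (simp add: regvec_def)
  then show ?thesis
    unfolding scalar_prod_def by (intro sum.cong) simp_all
qed

text \<open>The Gram structure: a quadratic form in the moments is the squared \<open>L\<^sup>2\<close> norm, under the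
  uniform distribution on \<open>[-1,1]\<close>, of the polynomial with coefficient vector \<open>u\<close>.\<close>

lemma Qmat_quadratic_form:
  assumes u: "u \<in> carrier_vec (Suc K)"
  shows "scalar_prod u (mult_mat_vec (Qmat K) u) =
         1/2 * integral {-1..1} (\<lambda>x. (scalar_prod u (regvec K x))\<^sup>2)"
proof -
  have entry: "Qmat K $$ (i, j) = integral {-1..1} (\<lambda>x. 1/2 * (x ^ i * x ^ j))"
    if "i \<le> K" "j \<le> K" for i j
    using that unfolding Qmat_def
    by (simp add: LINT_continuous_eq_integral[symmetric] continuous_intros del: set_integral_mult_right)
  have "{0..<Suc K} = {..K}" by auto
  then have "scalar_prod u (mult_mat_vec (Qmat K) u) =
      (\<Sum>i\<le>K. vec_index u i * (\<Sum>j\<le>K. Qmat K $$ (i, j) * vec_index u j))"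
    using u by (auto simp: scalar_prod_def mult_mat_vec_def Qmat_def intro!: sum.cong)
  also have "\<dots> = (\<Sum>i\<le>K. \<Sum>j\<le>K.
      integral {-1..1} (\<lambda>x. 1/2 * ((vec_index u i * x ^ i) * (vec_index u j * x ^ j))))"
    unfolding sum_distrib_left
  proof (intro sum.cong refl)
    fix i j assume ij: "i \<in> {..K}" "j \<in> {..K}"
    have "vec_index u i * (Qmat K $$ (i, j) * vec_index u j) =
        (vec_index u i * vec_index u j) * integral {-1..1} (\<lambda>x. 1/2 * (x ^ i * x ^ j))"
      using entry[of i j] ij by simp
    also have "\<dots> = integral {-1..1} (\<lambda>x. (vec_index u i * vec_index u j) * (1/2 * (x ^ i * x ^ j)))"
      by (rule integral_mult_right[symmetric])
    finally show "vec_index u i * (Qmat K $$ (i, j) * vec_index u j) =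
        integral {-1..1} (\<lambda>x. 1/2 * ((vec_index u i * x ^ i) * (vec_index u j * x ^ j)))"
      by (simp add: mult_ac)
  qed
  also have "\<dots> = (\<Sum>i\<le>K. integral {-1..1}
      (\<lambda>x. \<Sum>j\<le>K. 1/2 * ((vec_index u i * x ^ i) * (vec_index u j * x ^ j))))"
    by (intro sum.cong refl integral_sum[symmetric] integrable_continuous_real
        continuous_intros finite_atMost)
  also have "\<dots> = integral {-1..1}
      (\<lambda>x. \<Sum>i\<le>K. \<Sum>j\<le>K. 1/2 * ((vec_index u i * x ^ i) * (vec_index u j * x ^ j)))"
    by (intro integral_sum[symmetric] integrable_continuous_real continuous_intros finite_atMost)
  also have "\<dots> = integral {-1..1} (\<lambda>x. 1/2 * (scalar_prod u (regvec K x))\<^sup>2)"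
    by (simp only: scalar_prod_regvec power2_eq_square sum_product) (simp only: sum_distrib_left)
  finally show ?thesis by simp
qed

text \<open>A polynomial that vanishes on all of \<open>[-1,1]\<close> has infinitely many roots, so only the zero
  vector is annihilated by the quadratic form.\<close>

lemma Qmat_pos_def:
  assumes u: "u \<in> carrier_vec (Suc K)" and "u \<noteq> 0\<^sub>v (Suc K)"
  shows "0 < scalar_prod u (mult_mat_vec (Qmat K) u)"
proof -
  let ?p = "\<lambda>x. scalar_prod u (regvec K x)"
  have cont: "continuous_on {-1..1} (\<lambda>x. (?p x)\<^sup>2)"
    unfolding scalar_prod_regvec by (intro continuous_intros)
  have "integral {-1..1} (\<lambda>x. (?p x)\<^sup>2) \<noteq> 0"
  proof
    assume "integral {-1..1} (\<lambda>x. (?p x)\<^sup>2) = 0"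
    then have "\<forall>x\<in>{-1..1}. ?p x = 0"
      using integral_eq_0_iff[OF cont] by simp
    then have "{-1..1} \<subseteq> {x. (\<Sum>i\<le>K. vec_index u i * x ^ i) = 0}"
      unfolding scalar_prod_regvec by auto
    moreover have "infinite {-1..1::real}"
      by (simp add: infinite_Icc)
    ultimately have "\<not> finite {x. (\<Sum>i\<le>K. vec_index u i * x ^ i) = 0}"
      by (rule infinite_super)
    then have "\<forall>i\<le>K. vec_index u i = 0"
      unfolding polyfun_finite_roots by simp
    then have "u = 0\<^sub>v (Suc K)"
      using u by (intro eq_vecI) auto
    then show False using assms by simp
  qed
  moreover have "0 \<le> integral {-1..1} (\<lambda>x. (?p x)\<^sup>2)"
    by (intro integral_nonneg integrable_continuous_real cont) auto
  ultimately show ?thesis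
    unfolding Qmat_quadratic_form[OF u] by simp
qed

lemma Qmat_inverse:
  obtains B where "mat_inverse (Qmat K) = Some B" "B \<in> carrier_mat (Suc K) (Suc K)"
    "Qmat K * B = 1\<^sub>m (Suc K)"
proof -
  have "Determinant.det (Qmat K) \<noteq> 0"
  proof
    assume "Determinant.det (Qmat K) = 0"
    then obtain v where v: "v \<in> carrier_vec (Suc K)" "v \<noteq> 0\<^sub>v (Suc K)"
      and "mult_mat_vec (Qmat K) v = 0\<^sub>v (Suc K)"
      using det_0_iff_vec_prod_zero_field[OF Qmat_carrier] by blast
    then have "scalar_prod v (mult_mat_vec (Qmat K) v) = 0"
      by simp
    then show False
      using Qmat_pos_def[OF v] by simp
  qed
  then have "Qmat K \<in> Units (ring_mat TYPE(real) (Suc K) ())"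
    by (rule det_non_zero_imp_unit[OF Qmat_carrier])
  then obtain B where B: "mat_inverse (Qmat K) = Some B"
    using mat_inverse(1)[OF Qmat_carrier, of K "()"] by (cases "mat_inverse (Qmat K)") auto
  then show ?thesis
    using that[OF B] mat_inverse(2)[OF Qmat_carrier B] by simp
qed

text \<open>With \<open>u = Q\<^sup>-\<^sup>1 v\<close> the value \<open>v\<^sup>T Q\<^sup>-\<^sup>1 v\<close> equals \<open>u\<^sup>T Q u\<close>, and \<open>u\<close> is nonzero because the constant
  monomial makes the first entry of \<open>v\<close> equal to 1.\<close>

lemma hfun_pos: "0 < hfun K x"
proof -
  obtain B where B: "mat_inverse (Qmat K) = Some B" "B \<in> carrier_mat (Suc K) (Suc K)"
    "Qmat K * B = 1\<^sub>m (Suc K)" by (rule Qmat_inverse)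
  define u where "u = mult_mat_vec B (regvec K x)"
  have u: "u \<in> carrier_vec (Suc K)"
    using mult_mat_vec_carrier[OF B(2) regvec_carrier] by (simp add: u_def)
  have Qu: "mult_mat_vec (Qmat K) u = regvec K x"
    unfolding u_def using B(2,3)
    by (metis Qmat_carrier assoc_mult_mat_vec one_mult_mat_vec regvec_carrier)
  have "u \<noteq> 0\<^sub>v (Suc K)"
  proof
    assume "u = 0\<^sub>v (Suc K)"
    then have "regvec K x = 0\<^sub>v (Suc K)"
      unfolding Qu[symmetric] using carrier_matD[OF Qmat_carrier[of K]]
      by (intro eq_vecI) (simp_all add: scalar_prod_def)
    then have "vec_index (regvec K x) 0 = vec_index (0\<^sub>v (Suc K)) 0" by simp
    then show False by simp
  qed
  then have "0 < scalar_prod u (mult_mat_vec (Qmat K) u)"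
    by (rule Qmat_pos_def[OF u])
  also have "\<dots> = hfun K x"
    unfolding Qu hfun_def B(1) option.sel u_def[symmetric]
    by (rule comm_scalar_prod[OF u regvec_carrier])
  finally show ?thesis .
qed

lemma continuous_on_hfun [continuous_intros]: "continuous_on S (hfun K)"
proof -
  define B where "B = the (mat_inverse (Qmat K))"
  have B: "dim_row B = Suc K" "dim_col B = Suc K"
    using Qmat_inverse[of K] unfolding B_def by force+
  have "hfun K = (\<lambda>x. \<Sum>i = 0..<Suc K. x ^ i * (\<Sum>j = 0..<Suc K. B $$ (i, j) * x ^ j))"
    using B unfolding hfun_def B_def[symmetric]
    by (auto simp: fun_eq_iff scalar_prod_def mult_mat_vec_def regvec_def intro!: sum.cong)
  then show ?thesis
    by (auto intro!: continuous_intros)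
qed

lemma hmin_attained_and_least:
  shows "hmin K \<in> hfun K ` {-1..1}" and "x \<in> {-1..1} \<Longrightarrow> hmin K \<le> hfun K x"
proof -
  obtain y where y: "y \<in> {-1..1}" "\<And>x. x \<in> {-1..1} \<Longrightarrow> hfun K y \<le> hfun K x"
    using continuous_attains_inf[of "{-1..1::real}" "hfun K"] continuous_on_hfun by auto
  then have "hmin K = hfun K y"
    unfolding hmin_def by (intro Least_equality) auto
  then show "hmin K \<in> hfun K ` {-1..1}" "x \<in> {-1..1} \<Longrightarrow> hmin K \<le> hfun K x"
    using y by auto
qed

lemma hmin_pos: "0 < hmin K"
  using hmin_attained_and_least(1)[of K] hfun_pos[of K] by auto

section \<open>Optimality by weak duality\<close>

lemma nn_integral_hratio:
  assumes int: "set_integrable lebesgue {-1..1} (\<lambda>x. hfun K x / p x)"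
    and pos: "\<And>x. x \<in> {-1..1} \<Longrightarrow> 0 < p x"
  shows "(\<integral>\<^sup>+x\<in>{-1..1}. hratio K p x \<partial>lebesgue) =
      ennreal (LINT x:{-1..1}|lebesgue. hfun K x / p x)"
    and "0 \<le> (LINT x:{-1..1}|lebesgue. hfun K x / p x)"
proof -
  have nonneg: "0 \<le> indicator {-1..1} x *\<^sub>R (hfun K x / p x)" for x
    using pos[of x] hfun_pos[of K x] by (auto simp: indicator_def intro: less_imp_le)
  then show "0 \<le> (LINT x:{-1..1}|lebesgue. hfun K x / p x)"
    unfolding set_lebesgue_integral_def by (intro integral_nonneg_AE) auto
  have "(\<integral>\<^sup>+x\<in>{-1..1}. hratio K p x \<partial>lebesgue) =
      (\<integral>\<^sup>+x. ennreal (indicator {-1..1} x *\<^sub>R (hfun K x / p x)) \<partial>lebesgue)"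
    using pos by (intro nn_integral_cong) (force simp: indicator_def hratio_def)
  also have "\<dots> = ennreal (LINT x:{-1..1}|lebesgue. hfun K x / p x)"
    unfolding set_lebesgue_integral_def
    using int nonneg unfolding set_integrable_def by (intro nn_integral_eq_integral) auto
  finally show "(\<integral>\<^sup>+x\<in>{-1..1}. hratio K p x \<partial>lebesgue) =
      ennreal (LINT x:{-1..1}|lebesgue. hfun K x / p x)" .
qed

text \<open>In the duality argument \<open>g - s/2\<close> is the probability density that averages the supremum term:
  the constant \<open>s/2\<close> uses up mass \<open>s\<close> on an interval of length 2.\<close>

lemma LINT_excess_weight:
  fixes g :: "real \<Rightarrow> real"
  assumes g: "continuous_on {-1..1} g" "(LINT x:{-1..1}|lebesgue. g x) = s + 1"
  shows "(LINT x:{-1..1}|lebesgue. (g x - s / 2) * M) = M"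
proof -
  have "set_integrable lebesgue {-1..1} g"
    and "set_integrable lebesgue {-1..1::real} (\<lambda>x. s / 2)"
    by (intro set_integrable_continuous continuous_intros g)+
  then show ?thesis
    using g(2) LINT_const_design_interval[of "s / 2"] by (simp add: set_integral_diff(2))
qed

text \<open>The dual bound. Replacing the supremum by its average against \<open>g - s/2\<close> leaves \<open>\<integral> g h / \<pi>\<close>, and
  the tangent-line inequality \<open>p\<^sup>2 / \<pi> \<ge> 2 p - \<pi>\<close> linearises the integrand, so that only the masses of
  \<open>p\<close> and \<open>\<pi>\<close> matter. If the supremum \<open>M\<close> is finite, \<open>h / \<pi>\<close> is bounded and its
  extended nonnegative integral becomes an ordinary one.\<close>

lemma risk_lower_bound:
  assumes "0 \<le> s"
    and g: "continuous_on {-1..1} g" "\<And>x. x \<in> {-1..1} \<Longrightarrow> s / 2 \<le> g x"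
      "(LINT x:{-1..1}|lebesgue. g x) = s + 1"
    and p: "continuous_on {-1..1} p" "(LINT x:{-1..1}|lebesgue. p x) = 1"
    and \<kappa>: "0 \<le> \<kappa>" "\<And>x. x \<in> {-1..1} \<Longrightarrow> g x * hfun K x = \<kappa> * (p x)\<^sup>2"
    and \<pi>: "\<pi> \<in> designs"
  shows "ennreal \<kappa> \<le> risk K s \<pi>"
proof (cases "(SUP x\<in>{-1..1}. hratio K \<pi> x) = \<infinity>")
  case True
  then show ?thesis by (simp only: risk_def) simp
next
  case False
  let ?S = "{-1..1::real}"
  let ?r = "\<lambda>x. hfun K x / \<pi> x"
  have \<pi>_int: "set_integrable lebesgue ?S \<pi>" and \<pi>_mass: "(LINT x:?S|lebesgue. \<pi> x) = 1"
    and \<pi>_nonneg: "\<And>x. x \<in> ?S \<Longrightarrow> 0 \<le> \<pi> x"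
    using \<pi> by (auto simp: designs_def)
  from False obtain M where M: "0 \<le> M" "(SUP x\<in>?S. hratio K \<pi> x) = ennreal M"
    by (metis ennreal_cases infinity_ennreal_def)
  have ratio_le: "hratio K \<pi> x \<le> ennreal M" if "x \<in> ?S" for x
    unfolding M(2)[symmetric] using that by (rule SUP_upper)
  have \<pi>_pos: "0 < \<pi> x" if "x \<in> ?S" for x
    using ratio_le[OF that] \<pi>_nonneg[OF that]
    by (cases "\<pi> x = 0") (auto simp: hratio_def top_unique)
  have ratio_eq: "hratio K \<pi> x = ennreal (?r x)" if "x \<in> ?S" for x
    using \<pi>_pos[OF that] by (simp add: hratio_def)
  have r_le: "?r x \<le> M" and r_nonneg: "0 \<le> ?r x" if "x \<in> ?S" for x
    using ratio_le[OF that] ratio_eq[OF that] M(1) \<pi>_pos[OF that] hfun_pos[of K x]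
    by (auto simp: ennreal_le_iff)
  have abs_r_le: "\<bar>?r x\<bar> \<le> M" if "x \<in> ?S" for x
    using r_le[OF that] r_nonneg[OF that] by (simp only: abs_of_nonneg)
  have r_int: "set_integrable lebesgue ?S ?r"
  proof -
    \<comment> \<open>\<open>\<pi>\<close> is measurable only after restriction to the interval; since \<open>0 / 0 = 0\<close>, the quotient of
      the restrictions is the restriction of the quotient.\<close>
    have "(\<lambda>x. (indicator ?S x *\<^sub>R hfun K x) / (indicator ?S x *\<^sub>R \<pi> x)) \<in> borel_measurable lebesgue"
      using \<pi>_int set_integrable_continuous[OF continuous_on_hfun[of ?S K]]
      unfolding set_integrable_def by (intro borel_measurable_divide borel_measurable_integrable)
    moreover have "(\<lambda>x. (indicator ?S x *\<^sub>R hfun K x) / (indicator ?S x *\<^sub>R \<pi> x)) =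
        (\<lambda>x. indicator ?S x *\<^sub>R ?r x)"
      by (auto simp: indicator_def)
    ultimately have meas: "(\<lambda>x. indicator ?S x *\<^sub>R ?r x) \<in> borel_measurable lebesgue" by simp
    have "integrable lebesgue (\<lambda>x. indicator ?S x *\<^sub>R M)"
      using set_integrable_continuous[of "-1" 1 "\<lambda>x. M"] unfolding set_integrable_def by simp
    then show ?thesis
      unfolding set_integrable_def
      by (rule Bochner_Integration.integrable_bound[OF _ meas])
        (use abs_r_le M(1) in \<open>auto simp: indicator_def\<close>)
  qed
  have nn: "(\<integral>\<^sup>+x\<in>?S. hratio K \<pi> x \<partial>lebesgue) = ennreal (LINT x:?S|lebesgue. ?r x)"
    and r_integral_nonneg: "0 \<le> (LINT x:?S|lebesgue. ?r x)"
    using nn_integral_hratio[OF r_int \<pi>_pos] by simp_all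
  then have scaled: "ennreal (s / 2) * ennreal (LINT x:?S|lebesgue. ?r x) =
      ennreal (s / 2 * (LINT x:?S|lebesgue. ?r x))"
    using \<open>0 \<le> s\<close> by (intro ennreal_mult[symmetric]) auto
  have risk: "risk K s \<pi> = ennreal (s / 2 * (LINT x:?S|lebesgue. ?r x) + M)"
    unfolding risk_def nn M(2) scaled using \<open>0 \<le> s\<close> M(1) r_integral_nonneg
    by (simp add: ennreal_plus)
  have p_int: "set_integrable lebesgue ?S (\<lambda>x. \<kappa> * (2 * p x))"
    by (intro set_integrable_continuous continuous_intros p)
  have sr_int: "set_integrable lebesgue ?S (\<lambda>x. s / 2 * ?r x)"
    using r_int by (intro set_integrable_mult_right)
  have gs_int: "set_integrable lebesgue ?S (\<lambda>x. (g x - s / 2) * M)"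
    by (intro set_integrable_continuous continuous_intros g)
  have "\<kappa> = (LINT x:?S|lebesgue. \<kappa> * (2 * p x)) - (LINT x:?S|lebesgue. \<kappa> * \<pi> x)"
    using p(2) \<pi>_mass by simp
  also have "\<dots> = (LINT x:?S|lebesgue. \<kappa> * (2 * p x) - \<kappa> * \<pi> x)"
    using p_int \<pi>_int by (intro set_integral_diff(2)[symmetric]) auto
  also have "\<dots> \<le> (LINT x:?S|lebesgue. s / 2 * ?r x + (g x - s / 2) * M)"
  proof (rule set_integral_mono)
    show "set_integrable lebesgue ?S (\<lambda>x. \<kappa> * (2 * p x) - \<kappa> * \<pi> x)"
      using p_int \<pi>_int by (intro set_integral_diff(1)) auto
    show "set_integrable lebesgue ?S (\<lambda>x. s / 2 * ?r x + (g x - s / 2) * M)"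
      by (intro set_integral_add(1) sr_int gs_int)
    fix x assume x: "x \<in> ?S"
    \<comment> \<open>Expanding the square gives the tangent-line inequality.\<close>
    have "0 \<le> \<kappa> * ((p x - \<pi> x)\<^sup>2 / \<pi> x)"
      using \<kappa>(1) \<pi>_pos[OF x] by simp
    then have "\<kappa> * (2 * p x) - \<kappa> * \<pi> x \<le> \<kappa> * (p x)\<^sup>2 / \<pi> x"
      using \<pi>_pos[OF x] by (simp add: power2_eq_square field_simps)
    also have "\<dots> = s / 2 * ?r x + (g x - s / 2) * ?r x"
      using \<kappa>(2)[OF x] by (simp add: algebra_simps flip: add_divide_distrib)
    also have "\<dots> \<le> s / 2 * ?r x + (g x - s / 2) * M"
      using r_le[OF x] g(2)[OF x] by (intro add_left_mono mult_left_mono) auto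
    finally show "\<kappa> * (2 * p x) - \<kappa> * \<pi> x \<le> s / 2 * ?r x + (g x - s / 2) * M" .
  qed
  also have "\<dots> = (LINT x:?S|lebesgue. s / 2 * ?r x) + (LINT x:?S|lebesgue. (g x - s / 2) * M)"
    by (intro set_integral_add(2) sr_int gs_int)
  also have "(LINT x:?S|lebesgue. (g x - s / 2) * M) = M"
    by (rule LINT_excess_weight[OF g(1,3)])
  finally have "\<kappa> \<le> s / 2 * (LINT x:?S|lebesgue. ?r x) + M"
    by (simp only: set_integral_mult_right)
  then show ?thesis
    unfolding risk by (rule ennreal_leI)
qed

text \<open>Every inequality of the dual bound is an equality at \<open>\<pi> = p\<close>. Slackness lets \<open>M\<close> be replaced by
  \<open>h / p\<close> wherever \<open>g - s/2\<close> is nonzero, which turns the risk into \<open>\<integral> g h / p = \<kappa> \<integral> p\<close>.\<close>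

lemma risk_upper_bound:
  assumes "0 \<le> s"
    and g: "continuous_on {-1..1} g" "(LINT x:{-1..1}|lebesgue. g x) = s + 1"
    and p: "continuous_on {-1..1} p" "\<And>x. x \<in> {-1..1} \<Longrightarrow> 0 < p x"
      "(LINT x:{-1..1}|lebesgue. p x) = 1"
    and \<kappa>: "\<And>x. x \<in> {-1..1} \<Longrightarrow> g x * hfun K x = \<kappa> * (p x)\<^sup>2"
    and M: "\<And>x. x \<in> {-1..1} \<Longrightarrow> hfun K x / p x \<le> M"
    and slack: "\<And>x. x \<in> {-1..1} \<Longrightarrow> g x = s / 2 \<or> hfun K x / p x = M"
  shows "risk K s p \<le> ennreal \<kappa>"
proof -
  let ?S = "{-1..1::real}"
  let ?r = "\<lambda>x. hfun K x / p x"
  have r_pos: "0 < ?r x" if "x \<in> ?S" for x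
    using p(2)[OF that] hfun_pos[of K x] by simp
  then have "0 \<le> M"
    using M[of 0] less_imp_le[OF r_pos[of 0]] by (auto intro: order_trans)
  have ratio_eq: "hratio K p x = ennreal (?r x)" if "x \<in> ?S" for x
    using p(2)[OF that] by (simp add: hratio_def)
  have r_int: "set_integrable lebesgue ?S ?r"
    by (intro set_integrable_continuous continuous_intros p) (use p(2) in force)
  have nn: "(\<integral>\<^sup>+x\<in>?S. hratio K p x \<partial>lebesgue) = ennreal (LINT x:?S|lebesgue. ?r x)"
    and r_integral_nonneg: "0 \<le> (LINT x:?S|lebesgue. ?r x)"
    using nn_integral_hratio[OF r_int p(2)] by simp_all
  then have scaled: "ennreal (s / 2) * ennreal (LINT x:?S|lebesgue. ?r x) =
      ennreal (s / 2 * (LINT x:?S|lebesgue. ?r x))"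
    using \<open>0 \<le> s\<close> by (intro ennreal_mult[symmetric]) auto
  have "(SUP x\<in>?S. hratio K p x) \<le> ennreal M"
    using M ratio_eq by (intro SUP_least) (auto intro: ennreal_leI)
  then have "risk K s p \<le> ennreal (s / 2 * (LINT x:?S|lebesgue. ?r x)) + ennreal M"
    unfolding risk_def nn scaled by (rule add_left_mono)
  also have "\<dots> = ennreal (s / 2 * (LINT x:?S|lebesgue. ?r x) + M)"
    using \<open>0 \<le> s\<close> \<open>0 \<le> M\<close> r_integral_nonneg by (simp add: ennreal_plus)
  also have "s / 2 * (LINT x:?S|lebesgue. ?r x) + M = \<kappa>"
  proof -
    have sr_int: "set_integrable lebesgue ?S (\<lambda>x. s / 2 * ?r x)"
      using r_int by (intro set_integrable_mult_right)
    have gs_int: "set_integrable lebesgue ?S (\<lambda>x. (g x - s / 2) * M)"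
      by (intro set_integrable_continuous continuous_intros g)
    have "s / 2 * (LINT x:?S|lebesgue. ?r x) + M =
        (LINT x:?S|lebesgue. s / 2 * ?r x) + (LINT x:?S|lebesgue. (g x - s / 2) * M)"
      by (simp only: LINT_excess_weight[OF g] set_integral_mult_right)
    also have "\<dots> = (LINT x:?S|lebesgue. s / 2 * ?r x + (g x - s / 2) * M)"
      by (intro set_integral_add(2)[symmetric] sr_int gs_int)
    also have "\<dots> = (LINT x:?S|lebesgue. \<kappa> * p x)"
    proof (rule set_lebesgue_integral_cong)
      show "\<forall>x. x \<in> ?S \<longrightarrow> s / 2 * ?r x + (g x - s / 2) * M = \<kappa> * p x"
      proof (intro allI impI)
        fix x assume x: "x \<in> ?S"
        have "s / 2 * ?r x + (g x - s / 2) * M = s / 2 * ?r x + (g x - s / 2) * ?r x"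
          using slack[OF x] by auto
        also have "\<dots> = g x * hfun K x / p x"
          by (simp add: algebra_simps flip: add_divide_distrib)
        also have "\<dots> = \<kappa> * p x"
          using \<kappa>[OF x] p(2)[OF x] by (simp add: power2_eq_square)
        finally show "s / 2 * ?r x + (g x - s / 2) * M = \<kappa> * p x" .
      qed
    qed simp
    also have "\<dots> = \<kappa>" using p(3) by simp
    finally show ?thesis .
  qed
  finally show ?thesis .
qed

lemma optimal_design_certificate:
  assumes "0 \<le> s"
    and g: "continuous_on {-1..1} g" "\<And>x. x \<in> {-1..1} \<Longrightarrow> s / 2 \<le> g x"
      "(LINT x:{-1..1}|lebesgue. g x) = s + 1"
    and p: "continuous_on {-1..1} p" "\<And>x. x \<in> {-1..1} \<Longrightarrow> 0 < p x"
      "(LINT x:{-1..1}|lebesgue. p x) = 1"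
    and \<kappa>: "0 \<le> \<kappa>" "\<And>x. x \<in> {-1..1} \<Longrightarrow> g x * hfun K x = \<kappa> * (p x)\<^sup>2"
    and M: "\<And>x. x \<in> {-1..1} \<Longrightarrow> hfun K x / p x \<le> M"
    and slack: "\<And>x. x \<in> {-1..1} \<Longrightarrow> g x = s / 2 \<or> hfun K x / p x = M"
  shows "p \<in> designs \<and> (\<forall>\<pi>\<in>designs. risk K s p \<le> risk K s \<pi>)"
proof (intro conjI ballI)
  show "p \<in> designs"
    using p set_integrable_continuous[OF p(1)] by (auto simp: designs_def less_imp_le)
  fix \<pi> assume "\<pi> \<in> designs"
  have "risk K s p \<le> ennreal \<kappa>"
    by (rule risk_upper_bound[OF assms(1) g(1,3) p \<kappa>(2) M slack])
  also have "\<dots> \<le> risk K s \<pi>"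
    by (rule risk_lower_bound[OF assms(1) g p(1,3) \<kappa> \<open>\<pi> \<in> designs\<close>])
  finally show "risk K s p \<le> risk K s \<pi>" .
qed

section \<open>The two regimes\<close>

text \<open>On \<^term>\<open>Bset K h0\<close> the difference \<open>h0 - max h h0\<close> is the integrand in the numerator of
  \<^term>\<open>ffun K h0\<close>, and it vanishes elsewhere. This ties \<^const>\<open>ffun\<close> to the total mass of the dual weights in both
  regimes.\<close>

lemma LINT_max_hfun:
  assumes "h0 \<noteq> 0"
  shows "(LINT x:{-1..1}|lebesgue. max (hfun K x) h0) = h0 * (2 - ffun K h0)"
proof -
  have max_int: "set_integrable lebesgue {-1..1} (\<lambda>x. max (hfun K x) h0)"
    and c_int: "set_integrable lebesgue {-1..1::real} (\<lambda>x. h0)"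
    by (intro set_integrable_continuous continuous_intros)+
  have "h0 * ffun K h0 = (LINT x:Bset K h0|lebesgue. h0 - hfun K x)"
    using assms by (simp add: ffun_def)
  also have "\<dots> = (LINT x:{-1..1}|lebesgue. h0 - max (hfun K x) h0)"
    unfolding set_lebesgue_integral_def
    by (rule Bochner_Integration.integral_cong) (auto simp: Bset_def indicator_def)
  also have "\<dots> = 2 * h0 - (LINT x:{-1..1}|lebesgue. max (hfun K x) h0)"
    using set_integral_diff(2)[OF c_int max_int] LINT_const_design_interval[of h0] by simp
  finally show ?thesis by (simp add: algebra_simps)
qed

lemma ffun_hmin_nonpos: "ffun K (hmin K) \<le> 0"
proof -
  have "0 \<le> (LINT x:Bset K (hmin K)|lebesgue. hfun K x - hmin K)"
    unfolding set_lebesgue_integral_def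
    by (intro integral_nonneg_AE) (auto simp: Bset_def indicator_def)
  also have "\<dots> = - (LINT x:Bset K (hmin K)|lebesgue. hmin K - hfun K x)"
    unfolding set_lebesgue_integral_def Bochner_Integration.integral_minus[symmetric]
    by (intro Bochner_Integration.integral_cong) (auto simp: algebra_simps)
  finally show ?thesis
    unfolding ffun_def using hmin_pos[of K] by (simp add: divide_nonpos_pos)
qed

text \<open>This makes \<open>\<sigma>\<^sup>2\<close> strictly positive above the threshold, so that the equation
  \<^term>\<open>ffun K h0 = - 2 / \<sigma>2\<close> does not divide by zero.\<close>

lemma sigma2_min_nonneg: "0 \<le> sigma2_min K"
proof -
  have "ffun K (hmin K) \<le> 0" by (rule ffun_hmin_nonpos)
  then show ?thesis by (simp add: sigma2_min_def divide_nonpos_nonpos)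
qed

lemma design_small_optimal:
  assumes "0 \<le> s" and s: "s \<le> sigma2_min K"
  shows "design_small K \<in> designs \<and> (\<forall>\<pi>\<in>designs. risk K s (design_small K) \<le> risk K s \<pi>)"
proof -
  define H where "H = (LINT t:{-1..1}|lebesgue. hfun K t)"
  have "0 < H"
    unfolding H_def by (intro LINT_continuous_pos continuous_on_hfun hfun_pos) simp
  \<comment> \<open>At the minimum, \<open>max h hmin\<close> is \<open>h\<close> itself, so \<^const>\<open>ffun\<close> measures the total mass of \<open>h\<close>.\<close>
  have H_eq: "H = hmin K * (2 - ffun K (hmin K))"
    unfolding H_def using hmin_pos[of K] hmin_attained_and_least(2)[of _ K]
    by (subst LINT_max_hfun[symmetric]) (auto intro!: set_lebesgue_integral_cong simp: max_absorb1)
  \<comment> \<open>When \<^term>\<open>ffun K (hmin K)\<close> is 0 the bound is immediate; otherwise it is the hypothesis on \<open>s\<close>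
    with the denominator cleared.\<close>
  have "- (s * ffun K (hmin K)) \<le> 2"
  proof (cases "ffun K (hmin K) = 0")
    case False
    then show ?thesis
      using s ffun_hmin_nonpos[of K] by (simp add: sigma2_min_def field_simps)
  qed simp
  then have "s * H \<le> 2 * hmin K * (s + 1)"
    using mult_left_mono[of "- (s * ffun K (hmin K))" 2 "hmin K"] hmin_pos[of K]
    by (simp add: H_eq algebra_simps)
  then have weight_at_hmin: "s / 2 \<le> (s + 1) / H * hmin K"
    using \<open>0 < H\<close> by (simp add: field_simps)
  show ?thesis
  proof (rule optimal_design_certificate[where g = "\<lambda>x. (s + 1) / H * hfun K x"
        and \<kappa> = "(s + 1) * H" and M = H])
    show "s / 2 \<le> (s + 1) / H * hfun K x" if "x \<in> {-1..1}" for x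
    proof -
      have "(s + 1) / H * hmin K \<le> (s + 1) / H * hfun K x"
        using hmin_attained_and_least(2)[OF that] \<open>0 \<le> s\<close> \<open>0 < H\<close>
        by (intro mult_left_mono) auto
      then show ?thesis by (rule order_trans[OF weight_at_hmin])
    qed
    show "continuous_on {-1..1} (\<lambda>x. (s + 1) / H * hfun K x)"
      by (intro continuous_intros)
    show "(LINT x:{-1..1}|lebesgue. (s + 1) / H * hfun K x) = s + 1"
      using \<open>0 < H\<close> by (simp add: H_def)
    show "continuous_on {-1..1} (design_small K)"
      unfolding design_small_def H_def[symmetric] using \<open>0 < H\<close>
      by (intro continuous_intros) auto
    show "(LINT x:{-1..1}|lebesgue. design_small K x) = 1"
      unfolding design_small_def H_def[symmetric] using \<open>0 < H\<close>
      by (simp add: H_def[symmetric])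
  qed (use \<open>0 < H\<close> \<open>0 \<le> s\<close> hfun_pos[of K] in
      \<open>auto simp: design_small_def H_def[symmetric] power2_eq_square less_imp_neq[THEN not_sym]\<close>)
qed

lemma design_large_optimal:
  assumes "0 < s" "0 < h0" and f: "ffun K h0 = - 2 / s"
  shows "design_large K h0 \<in> designs \<and> (\<forall>\<pi>\<in>designs. risk K s (design_large K h0) \<le> risk K s \<pi>)"
proof -
  \<comment> \<open>A single continuous formula for the two branches of the shape.\<close>
  define q where "q = (\<lambda>x. sqrt (hfun K x * max (hfun K x) h0))"
  have shape: "design_large_shape K h0 x = q x" if "x \<in> {-1..1}" for x
    using that hfun_pos[of K x]
    by (auto simp: design_large_shape_def q_def Aset_def max_def real_sqrt_mult mult.commute)
  define c where "c = 1 / (LINT t:{-1..1}|lebesgue. design_large_shape K h0 t)"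
  have q_pos: "0 < q x" for x
    using hfun_pos[of K x] \<open>0 < h0\<close> by (simp add: q_def)
  have q_cont: "continuous_on {-1..1} q"
    unfolding q_def by (intro continuous_intros)
  have c_eq: "c = 1 / (LINT t:{-1..1}|lebesgue. q t)"
    unfolding c_def using shape by (subst set_lebesgue_integral_cong[where g = q]) auto
  have "0 < c"
    unfolding c_eq using LINT_continuous_pos[OF q_cont _ q_pos] by simp
  have p_eq: "design_large K h0 x = c * q x" if "x \<in> {-1..1}" for x
    using shape[OF that] by (simp add: design_large_def c_def)
  have q_sq: "(q x)\<^sup>2 = hfun K x * max (hfun K x) h0" for x
    using hfun_pos[of K x] \<open>0 < h0\<close> by (simp add: q_def)
  have ratio_le: "hfun K x / (c * q x) \<le> 1 / c"
    and ratio_eq: "h0 < hfun K x \<Longrightarrow> hfun K x / (c * q x) = 1 / c" for x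
  proof -
    have "hfun K x \<le> q x"
      unfolding q_def using hfun_pos[of K x]
      by (intro real_le_rsqrt) (simp add: power2_eq_square)
    then show "hfun K x / (c * q x) \<le> 1 / c"
      using \<open>0 < c\<close> q_pos[of x] by (simp add: field_simps)
    assume "h0 < hfun K x"
    then have "q x = hfun K x"
      using hfun_pos[of K x] by (simp add: q_def)
    then show "hfun K x / (c * q x) = 1 / c"
      using hfun_pos[of K x] by simp
  qed
  show ?thesis
  proof (rule optimal_design_certificate[where g = "\<lambda>x. s / (2 * h0) * max (hfun K x) h0"
        and \<kappa> = "s / (2 * h0 * c\<^sup>2)" and M = "1 / c"])
    show "s / 2 \<le> s / (2 * h0) * max (hfun K x) h0" if "x \<in> {-1..1}" for x
    proof -
      have "s / (2 * h0) * h0 \<le> s / (2 * h0) * max (hfun K x) h0"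
        using \<open>0 < s\<close> \<open>0 < h0\<close> by (intro mult_left_mono) auto
      then show ?thesis using \<open>0 < h0\<close> by simp
    qed
    show "continuous_on {-1..1} (\<lambda>x. s / (2 * h0) * max (hfun K x) h0)"
      by (intro continuous_intros)
    have "(LINT x:{-1..1}|lebesgue. s / (2 * h0) * max (hfun K x) h0) = s / (2 * h0) * (h0 * (2 + 2 / s))"
      using LINT_max_hfun[of h0 K] f \<open>0 < h0\<close> by simp
    also have "\<dots> = s + 1"
      using \<open>0 < h0\<close> \<open>0 < s\<close> by (simp add: field_simps)
    finally show "(LINT x:{-1..1}|lebesgue. s / (2 * h0) * max (hfun K x) h0) = s + 1" .
    show "continuous_on {-1..1} (design_large K h0)"
      by (rule continuous_on_eq[where f = "\<lambda>x. c * q x"])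
        (use p_eq in \<open>auto intro!: continuous_intros q_cont\<close>)
    have "(LINT x:{-1..1}|lebesgue. design_large K h0 x) = (LINT x:{-1..1}|lebesgue. c * q x)"
      using p_eq by (intro set_lebesgue_integral_cong) auto
    also have "\<dots> = 1"
      using \<open>0 < c\<close> by (auto simp: c_eq)
    finally show "(LINT x:{-1..1}|lebesgue. design_large K h0 x) = 1" .
    show "0 < design_large K h0 x" if "x \<in> {-1..1}" for x
      using p_eq[OF that] \<open>0 < c\<close> q_pos[of x] by simp
    show "s / (2 * h0) * max (hfun K x) h0 * hfun K x
        = s / (2 * h0 * c\<^sup>2) * (design_large K h0 x)\<^sup>2" if "x \<in> {-1..1}" for x
      using \<open>0 < c\<close> by (simp add: p_eq[OF that] power_mult_distrib q_sq)
    show "hfun K x / design_large K h0 x \<le> 1 / c" if "x \<in> {-1..1}" for x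
      using ratio_le[of x] p_eq[OF that] by simp
    show "s / (2 * h0) * max (hfun K x) h0 = s / 2 \<or> hfun K x / design_large K h0 x = 1 / c"
      if "x \<in> {-1..1}" for x
    proof (cases "h0 < hfun K x")
      case True
      then show ?thesis using ratio_eq[of x] p_eq[OF that] by simp
    next
      case False
      then show ?thesis using \<open>0 < h0\<close> by (simp add: max_def)
    qed
  qed (use \<open>0 < s\<close> \<open>0 < h0\<close> in auto)
qed

theorem theorem2:
  fixes K :: nat and \<sigma>2 :: real
  assumes "K \<ge> 1" and "\<sigma>2 \<ge> 0"
  shows "(\<sigma>2 \<le> sigma2_min K \<longrightarrow>
            design_small K \<in> designs \<and>
            (\<forall>\<pi>\<in>designs. risk K \<sigma>2 (design_small K) \<le> risk K \<sigma>2 \<pi>)) \<and>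
         (\<sigma>2 > sigma2_min K \<longrightarrow>
            (\<forall>h0\<in>{hmin K..hmax K}. ffun K h0 = - 2 / \<sigma>2 \<longrightarrow>
               design_large K h0 \<in> designs \<and>
               (\<forall>\<pi>\<in>designs. risk K \<sigma>2 (design_large K h0) \<le> risk K \<sigma>2 \<pi>)))"
proof (intro conjI[of "_ \<longrightarrow> _"] impI ballI)
  assume "\<sigma>2 \<le> sigma2_min K"
  then show "design_small K \<in> designs \<and>
      (\<forall>\<pi>\<in>designs. risk K \<sigma>2 (design_small K) \<le> risk K \<sigma>2 \<pi>)"
    by (rule design_small_optimal[OF assms(2)])
next
  fix h0
  assume "sigma2_min K < \<sigma>2" and "h0 \<in> {hmin K..hmax K}" and f: "ffun K h0 = - 2 / \<sigma>2"
  then have "0 < \<sigma>2" "0 < h0"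
    using sigma2_min_nonneg[of K] hmin_pos[of K] by auto
  then show "design_large K h0 \<in> designs \<and>
      (\<forall>\<pi>\<in>designs. risk K \<sigma>2 (design_large K h0) \<le> risk K \<sigma>2 \<pi>)"
    using f by (rule design_large_optimal)
qed

end
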